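(* Let $D$ be a multidigraph that does not contain any cycle-piercing edge. Then the tree conflict hypergraph $\mathcal{H}^{\mathbf{t}}_D$ is W-chordal. As a result, the directed tree complex $\mathrm{DT}(D)$ is shellable.
   Context: A multidigraph $D$ consists of finite sets $V(D)$, $E(D)$ and maps $s,t:E(D)\to V(D)$ (source, target). Edges $e\ne f$ are parallel if $s(e)=s(f)$ and $t(e)=t(f)$. For $\sigma\subseteq E(D)$, $D[\sigma]$ is the multidigraph with edge set $\sigma$ and vertex set the endpoints of edges of $\sigma$. A directed cycle is a connected multidigraph without parallel edges in which every vertex has in-degree and out-degree $1$. An edge $e$ of $D$ is cycle-piercing if there is $\sigma\subseteq E(D)$ with $D[\sigma]$ a directed cycle and an edge $f\in\sigma$ with $t(e)=t(f)$ but $s(e)\ne s(f)$. A hypergraph $\mathcal{H}$ on a finite vertex set $V(\mathcal{H})$ is a family of subsets (hyperedges), none contained in another. The tree conflict hypergraph $\mathcal{H}^{\mathbf{t}}_D$ has vertex set $E(D)$ and hyperedges: all $\sigma\subseteq E(D)$ with $D[\sigma]$ a directed cycle; all pairs $\{e,f\}$ of parallel edges; all pairs $\{e,f\}$ with $s(e)\ne s(f)$ and $t(e)=t(f)$. For $v\in V(\mathcal{H})$, the deletion $\mathcal{H}\setminus v$ has vertex set $V(\mathcal{H})\setminus\{v\}$ and hyperedges those not containing $v$; the contraction $\mathcal{H}/v$ has vertex set $V(\mathcal{H})\setminus\{v\}$ and hyperedges the inclusion-minimal sets among $\{e\setminus\{v\}: e \text{ a hyperedge of } \mathcal{H}\}$.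 A minor is obtained by repeated deletions and/or contractions. A vertex $v$ is simplicial if for any two distinct hyperedges $e_1,e_2$ containing $v$ there is a hyperedge $e_3\subseteq (e_1\cup e_2)\setminus\{v\}$. $\mathcal{H}$ is W-chordal if every minor of $\mathcal{H}$ has a simplicial vertex. A directed forest is a digraph with no directed cycles in which no two distinct edges share a target; $\mathrm{DT}(D)$ is the simplicial complex on $E(D)$ whose faces are the $\sigma$ with $D[\sigma]$ a directed forest. A simplicial complex is shellable if its facets can be ordered $\sigma_1,\dots,\sigma_s$ so that for each $i\ge2$, $\langle\sigma_i\rangle\cap\langle\sigma_1,\dots,\sigma_{i-1}\rangle$ is pure of dimension $\dim\sigma_i-1$. *)

theory Defs
  imports "Graph_Theory.Digraph_Component"
begin

text \<open>A multidigraph is a \<^locale>\<open>fin_digraph\<close>; loops and parallel arcs are allowed, the source of an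
  arc is its \<^const>\<open>tail\<close> and the target its \<^const>\<open>head\<close>.\<close>

section \<open>Multidigraphs\<close>

definition edge_subgraph :: "('a, 'b) pre_digraph \<Rightarrow> 'b set \<Rightarrow> ('a, 'b) pre_digraph" where
  "edge_subgraph D \<sigma> =
     \<lparr> verts = tail D ` \<sigma> \<union> head D ` \<sigma>, arcs = \<sigma>, tail = tail D, head = head D \<rparr>"

definition parallel :: "('a, 'b) pre_digraph \<Rightarrow> 'b \<Rightarrow> 'b \<Rightarrow> bool" where
  "parallel D e f \<longleftrightarrow> e \<noteq> f \<and> tail D e = tail D f \<and> head D e = head D f"

text \<open>\<^const>\<open>connected\<close> includes non-emptiness, so the null graph is not a directed cycle. A single
  loop is one.\<close>

definition directed_cycle :: "('a, 'b) pre_digraph \<Rightarrow> bool" where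
  "directed_cycle G \<longleftrightarrow>
     connected G \<and> (\<forall>e\<in>arcs G. \<forall>f\<in>arcs G. \<not> parallel G e f) \<and>
     (\<forall>v\<in>verts G. in_degree G v = 1 \<and> out_degree G v = 1)"

definition cycle_piercing :: "('a, 'b) pre_digraph \<Rightarrow> 'b \<Rightarrow> bool" where
  "cycle_piercing D e \<longleftrightarrow> e \<in> arcs D \<and>
     (\<exists>\<sigma>\<subseteq>arcs D. directed_cycle (edge_subgraph D \<sigma>) \<and>
        (\<exists>f\<in>\<sigma>. head D e = head D f \<and> tail D e \<noteq> tail D f))"

text \<open>The first conjunct says that the graph is a digraph, i.e. has no parallel arcs (it is implied
  by the last one).\<close>

definition directed_forest :: "('a, 'b) pre_digraph \<Rightarrow> bool" where
  "directed_forest G \<longleftrightarrow>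
     (\<forall>e\<in>arcs G. \<forall>f\<in>arcs G. \<not> parallel G e f) \<and>
     \<not> (\<exists>\<sigma>\<subseteq>arcs G. directed_cycle (edge_subgraph G \<sigma>)) \<and>
     (\<forall>e\<in>arcs G. \<forall>f\<in>arcs G. e \<noteq> f \<longrightarrow> head G e \<noteq> head G f)"


section \<open>Hypergraphs\<close>

record 'v hypergraph =
  hverts :: "'v set"
  hedges :: "'v set set"

definition is_hypergraph :: "'v hypergraph \<Rightarrow> bool" where
  "is_hypergraph H \<longleftrightarrow> finite (hverts H) \<and> (\<forall>e\<in>hedges H. e \<subseteq> hverts H) \<and>
     (\<forall>e\<in>hedges H. \<forall>f\<in>hedges H. e \<subseteq> f \<longrightarrow> e = f)"

definition minimal_sets :: "'v set set \<Rightarrow> 'v set set" where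
  "minimal_sets F = {e \<in> F. \<forall>f\<in>F. f \<subseteq> e \<longrightarrow> f = e}"

definition deletion :: "'v hypergraph \<Rightarrow> 'v \<Rightarrow> 'v hypergraph" where
  "deletion H v = \<lparr> hverts = hverts H - {v}, hedges = {e \<in> hedges H. v \<notin> e} \<rparr>"

definition contraction :: "'v hypergraph \<Rightarrow> 'v \<Rightarrow> 'v hypergraph" where
  "contraction H v =
     \<lparr> hverts = hverts H - {v}, hedges = minimal_sets ((\<lambda>e. e - {v}) ` hedges H) \<rparr>"

inductive minor :: "'v hypergraph \<Rightarrow> 'v hypergraph \<Rightarrow> bool" for H :: "'v hypergraph" where
  minor_refl: "minor H H"
| minor_del: "minor H K \<Longrightarrow> v \<in> hverts K \<Longrightarrow> minor H (deletion K v)"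
| minor_contr: "minor H K \<Longrightarrow> v \<in> hverts K \<Longrightarrow> minor H (contraction K v)"

definition simplicial_vertex :: "'v hypergraph \<Rightarrow> 'v \<Rightarrow> bool" where
  "simplicial_vertex H v \<longleftrightarrow> v \<in> hverts H \<and>
     (\<forall>e1\<in>hedges H. \<forall>e2\<in>hedges H. e1 \<noteq> e2 \<and> v \<in> e1 \<and> v \<in> e2 \<longrightarrow>
        (\<exists>e3\<in>hedges H. e3 \<subseteq> (e1 \<union> e2) - {v}))"

text \<open>Removing all vertices yields a minor without vertices, which has no simplicial vertex for
  trivial reasons; such minors are not considered.\<close>

definition W_chordal :: "'v hypergraph \<Rightarrow> bool" where
  "W_chordal H \<longleftrightarrow> (\<forall>K. minor H K \<and> hverts K \<noteq> {} \<longrightarrow> (\<exists>v. simplicial_vertex K v))"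

text \<open>If \<open>D\<close> has parallel loops, or an arc that enters the base point of a loop from a different
  vertex, then the family below is not an antichain; it is nevertheless used as it stands, without
  passing to minimal sets. See \<open>is_hypergraph_tree_conflict\<close>.\<close>

definition tree_conflict_hypergraph :: "('a, 'b) pre_digraph \<Rightarrow> 'b hypergraph" where
  "tree_conflict_hypergraph D =
     \<lparr> hverts = arcs D,
       hedges = {\<sigma>. \<sigma> \<subseteq> arcs D \<and> directed_cycle (edge_subgraph D \<sigma>)}
         \<union> {{e, f} | e f. e \<in> arcs D \<and> f \<in> arcs D \<and> parallel D e f}
         \<union> {{e, f} | e f. e \<in> arcs D \<and> f \<in> arcs D \<and> tail D e \<noteq> tail D f \<and> head D e = head D f} \<rparr>"


section \<open>Simplicial complexes\<close>

text \<open>A complex is given by its set of faces, including the empty face, which has dimension -1.\<close>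

definition simplicial_complex :: "'v set \<Rightarrow> 'v set set \<Rightarrow> bool" where
  "simplicial_complex V K \<longleftrightarrow> finite V \<and> {} \<in> K \<and> (\<forall>\<sigma>\<in>K. \<sigma> \<subseteq> V \<and> (\<forall>\<tau>\<subseteq>\<sigma>. \<tau> \<in> K))"

definition facets :: "'v set set \<Rightarrow> 'v set set" where
  "facets K = {\<sigma> \<in> K. \<forall>\<tau>\<in>K. \<sigma> \<subseteq> \<tau> \<longrightarrow> \<sigma> = \<tau>}"

definition generated_complex :: "'v set set \<Rightarrow> 'v set set" where
  "generated_complex F = {\<tau>. \<exists>\<sigma>\<in>F. \<tau> \<subseteq> \<sigma>}"

definition face_dim :: "'v set \<Rightarrow> int" where
  "face_dim \<sigma> = int (card \<sigma>) - 1"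

definition pure_of_dim :: "'v set set \<Rightarrow> int \<Rightarrow> bool" where
  "pure_of_dim K d \<longleftrightarrow> (\<forall>\<sigma>\<in>facets K. face_dim \<sigma> = d)"

definition shellable :: "'v set set \<Rightarrow> bool" where
  "shellable K \<longleftrightarrow> (\<exists>\<sigma>s. distinct \<sigma>s \<and> set \<sigma>s = facets K \<and>
     (\<forall>i. 0 < i \<and> i < length \<sigma>s \<longrightarrow>
        pure_of_dim (generated_complex {\<sigma>s ! i} \<inter> generated_complex (set (take i \<sigma>s)))
          (face_dim (\<sigma>s ! i) - 1)))"

definition directed_tree_complex :: "('a, 'b) pre_digraph \<Rightarrow> 'b set set" where
  "directed_tree_complex D = {\<sigma>. \<sigma> \<subseteq> arcs D \<and> directed_forest (edge_subgraph D \<sigma>)}"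


section \<open>Sanity checks\<close>

lemma edge_subgraph_simps [simp]:
  "verts (edge_subgraph D \<sigma>) = tail D ` \<sigma> \<union> head D ` \<sigma>"
  "arcs (edge_subgraph D \<sigma>) = \<sigma>"
  "tail (edge_subgraph D \<sigma>) = tail D"
  "head (edge_subgraph D \<sigma>) = head D"
  "edge_subgraph (edge_subgraph D \<sigma>) \<tau> = edge_subgraph D \<tau>"
  "parallel (edge_subgraph D \<sigma>) = parallel D"
  by (auto simp: edge_subgraph_def parallel_def fun_eq_iff)

lemma not_directed_cycle_empty: "\<not> directed_cycle (edge_subgraph D {})"
  by (simp add: directed_cycle_def connected_def strongly_connected_def)

lemma directed_cycle_degree:
  assumes "directed_cycle (edge_subgraph D \<sigma>)" "v \<in> tail D ` \<sigma> \<union> head D ` \<sigma>"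
  shows "card {g \<in> \<sigma>. head D g = v} = 1" "card {g \<in> \<sigma>. tail D g = v} = 1"
  using assms
  unfolding directed_cycle_def in_degree_def out_degree_def in_arcs_def out_arcs_def
    edge_subgraph_simps
  by blast+

lemma directed_cycle_unique:
  assumes "directed_cycle (edge_subgraph D \<sigma>)" "e \<in> \<sigma>" "f \<in> \<sigma>"
  shows "head D e = head D f \<Longrightarrow> e = f" "tail D e = tail D f \<Longrightarrow> e = f"
proof -
  have "card {g \<in> \<sigma>. head D g = head D e} = 1"
    by (rule directed_cycle_degree(1)[OF assms(1)]) (use assms(2) in simp)
  then obtain a where a: "{g \<in> \<sigma>. head D g = head D e} = {a}"
    by (rule card_1_singletonE)
  show "e = f" if "head D e = head D f"
  proof -
    have "e \<in> {a}" "f \<in> {a}"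
      unfolding a[symmetric] using assms(2,3) that by simp_all
    then show ?thesis
      by simp
  qed
  have "card {g \<in> \<sigma>. tail D g = tail D e} = 1"
    by (rule directed_cycle_degree(2)[OF assms(1)]) (use assms(2) in simp)
  then obtain b where b: "{g \<in> \<sigma>. tail D g = tail D e} = {b}"
    by (rule card_1_singletonE)
  show "e = f" if "tail D e = tail D f"
  proof -
    have "e \<in> {b}" "f \<in> {b}"
      unfolding b[symmetric] using assms(2,3) that by simp_all
    then show ?thesis
      by simp
  qed
qed

lemma directed_cycle_edges:
  assumes "directed_cycle (edge_subgraph D \<sigma>)" "v \<in> tail D ` \<sigma> \<union> head D ` \<sigma>"
  shows "\<exists>e\<in>\<sigma>. head D e = v" "\<exists>e\<in>\<sigma>. tail D e = v"
proof -
  have "{g \<in> \<sigma>. head D g = v} \<noteq> {}"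
    using directed_cycle_degree(1)[OF assms] by (metis card.empty zero_neq_one)
  then show "\<exists>e\<in>\<sigma>. head D e = v"
    by simp blast
  have "{g \<in> \<sigma>. tail D g = v} \<noteq> {}"
    using directed_cycle_degree(2)[OF assms] by (metis card.empty zero_neq_one)
  then show "\<exists>e\<in>\<sigma>. tail D e = v"
    by simp blast
qed

lemma directed_cycle_minimal:
  assumes s: "directed_cycle (edge_subgraph D \<sigma>)" and t: "directed_cycle (edge_subgraph D \<tau>)"
    and sub: "\<sigma> \<subseteq> \<tau>"
  shows "\<sigma> = \<tau>"
proof
  let ?V = "tail D ` \<sigma> \<union> head D ` \<sigma>"
  have closed: "e \<in> \<sigma>" if "e \<in> \<tau>" "tail D e \<in> ?V \<or> head D e \<in> ?V" for e
  proof -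
    have "(\<exists>g\<in>\<sigma>. tail D g = tail D e) \<or> (\<exists>g\<in>\<sigma>. head D g = head D e)"
      using that(2) directed_cycle_edges(2)[OF s, of "tail D e"]
        directed_cycle_edges(1)[OF s, of "head D e"] by meson
    then obtain g where "g \<in> \<sigma>" "tail D e = tail D g \<or> head D e = head D g"
      by auto
    moreover from this have "g \<in> \<tau>"
      using sub by blast
    ultimately show ?thesis
      using directed_cycle_unique[OF t \<open>e \<in> \<tau>\<close>, of g] by blast
  qed
  have "\<sigma> \<noteq> {}"
    using s not_directed_cycle_empty by metis
  then obtain u where u: "u \<in> ?V"
    by blast
  have r: "v \<in> ?V" if "u \<rightarrow>\<^sup>*\<^bsub>mk_symmetric (edge_subgraph D \<tau>)\<^esub> v" for v
    using that unfolding reachable_def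
  proof (induction rule: rtrancl_on_induct)
    case base
    show ?case by (rule u)
  next
    case (step a b)
    have "(a, b) \<in> parcs (mk_symmetric (edge_subgraph D \<tau>))"
      using step(2) by simp
    then obtain e where "e \<in> \<tau>" "a = tail D e \<and> b = head D e \<or> a = head D e \<and> b = tail D e"
      unfolding parcs_mk_symmetric by auto
    moreover from this have "e \<in> \<sigma>"
      using closed[of e] step.IH by metis
    ultimately show ?case
      by auto
  qed
  have c: "u \<rightarrow>\<^sup>*\<^bsub>mk_symmetric (edge_subgraph D \<tau>)\<^esub> v" if "v \<in> tail D ` \<tau> \<union> head D ` \<tau>" for v
  proof -
    have "u \<in> tail D ` \<tau> \<union> head D ` \<tau>"
      using u sub by auto
    then show ?thesis
      using t that by (simp add: directed_cycle_def connected_def strongly_connected_def)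
  qed
  show "\<tau> \<subseteq> \<sigma>"
  proof
    fix e
    assume e: "e \<in> \<tau>"
    have "tail D e \<in> ?V"
      by (rule r, rule c) (use e in simp)
    then show "e \<in> \<sigma>"
      by (rule closed[OF e disjI1])
  qed
qed (rule sub)

lemma is_hypergraph_tree_conflict:
  assumes fin: "fin_digraph D"
    and pierce: "\<not> (\<exists>e. cycle_piercing D e)"
    and loops: "\<And>e f. e \<in> arcs D \<Longrightarrow> f \<in> arcs D \<Longrightarrow> parallel D e f \<Longrightarrow> tail D e \<noteq> head D e"
  shows "is_hypergraph (tree_conflict_hypergraph D)"
proof -
  let ?C = "\<lambda>\<sigma>. \<sigma> \<subseteq> arcs D \<and> directed_cycle (edge_subgraph D \<sigma>)"
  let ?P = "\<lambda>\<sigma>. \<exists>e f. \<sigma> = {e, f} \<and> e \<in> arcs D \<and> f \<in> arcs D \<and> e \<noteq> f \<and> head D e = head D f"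
  have edge: "?C \<sigma> \<or> ?P \<sigma>" if "\<sigma> \<in> hedges (tree_conflict_hypergraph D)" for \<sigma>
    using that by (auto simp: tree_conflict_hypergraph_def parallel_def)
  have single: False if \<sigma>: "?C \<sigma>" "\<sigma> \<subseteq> {e, f}" "\<sigma> \<noteq> {e, f}"
    and ef: "e \<in> arcs D" "f \<in> arcs D" "e \<noteq> f" "head D e = head D f" for \<sigma> e f
  proof -
    have False if g: "\<sigma> = {g}" "g \<in> arcs D" "h \<in> arcs D" "g \<noteq> h" "head D g = head D h" for g h
    proof -
      have "tail D g = head D g"
        using directed_cycle_edges(1)[of D \<sigma> "tail D g"] \<sigma>(1) g(1) by simp
      moreover have "tail D h = tail D g"
      proof (rule ccontr)
        assume "tail D h \<noteq> tail D g"
        then have "\<exists>f\<in>\<sigma>. head D h = head D f \<and> tail D h \<noteq> tail D f"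
          using g(1,5) by simp
        with \<sigma>(1) g(3) have "cycle_piercing D h"
          unfolding cycle_piercing_def by meson
        with pierce show False
          by simp
      qed
      ultimately show False
        using loops[of g h] g(2-5) by (simp add: parallel_def)
    qed
    moreover have "\<sigma> \<noteq> {}"
      using \<sigma>(1) not_directed_cycle_empty by metis
    then have "\<sigma> = {e} \<or> \<sigma> = {f}"
      using \<sigma>(2,3) by blast
    ultimately show False
      using ef by metis
  qed
  have anti: "\<sigma> = \<tau>" if st: "\<sigma> \<in> hedges (tree_conflict_hypergraph D)"
    "\<tau> \<in> hedges (tree_conflict_hypergraph D)" "\<sigma> \<subseteq> \<tau>" for \<sigma> \<tau>
  proof (cases "?C \<sigma>")
    case C: True
    show ?thesis
    proof (cases "?C \<tau>")
      case True
      then show ?thesis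
        using C directed_cycle_minimal[of D, OF _ _ st(3)] by simp
    next
      case False
      then obtain e f where "\<tau> = {e, f}" "e \<in> arcs D" "f \<in> arcs D" "e \<noteq> f" "head D e = head D f"
        using edge[OF st(2)] by blast
      then show ?thesis
        using single[of \<sigma> e f] C st(3) by blast
    qed
  next
    case False
    then obtain e f where ef: "\<sigma> = {e, f}" "e \<noteq> f" "head D e = head D f"
      using edge[OF st(1)] by blast
    then have "\<not> ?C \<tau>"
      using directed_cycle_unique(1)[of D \<tau> e f] st(3) by blast
    then obtain a b where "\<tau> = {a, b}"
      using edge[OF st(2)] by blast
    then show ?thesis
      using ef st(3) by auto
  qed
  have vs: "hverts (tree_conflict_hypergraph D) = arcs D"
    by (simp add: tree_conflict_hypergraph_def)
  have sub: "\<sigma> \<subseteq> arcs D" if "\<sigma> \<in> hedges (tree_conflict_hypergraph D)" for \<sigma>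
    using edge[OF that] by auto
  show ?thesis
    unfolding is_hypergraph_def vs
    by (intro conjI ballI impI fin_digraph.finite_arcs[OF fin] sub anti)
qed

lemma simplicial_complex_directed_tree_complex:
  assumes "fin_digraph D"
  shows "simplicial_complex (arcs D) (directed_tree_complex D)"
proof -
  have "directed_forest (edge_subgraph D {})"
    using not_directed_cycle_empty by (auto simp: directed_forest_def)
  moreover have "directed_forest (edge_subgraph D \<tau>)"
    if "directed_forest (edge_subgraph D \<sigma>)" "\<tau> \<subseteq> \<sigma>" for \<sigma> \<tau>
    using that unfolding directed_forest_def edge_subgraph_simps by (meson order_trans subsetD)
  ultimately show ?thesis
    using fin_digraph.finite_arcs[OF assms]
    by (auto simp: simplicial_complex_def directed_tree_complex_def)
qed

end

theory Submission
  imports Defs "HOL-Library.Nat_Bijection"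
begin

text \<open>The hyperedges satisfy the weak circuit elimination axiom of matroids, that is, every vertex
  is simplicial. A cycle \<open>C\<close> and an arc \<open>a\<close> sharing its head with some \<open>v \<in> C\<close> give the cycle
  \<open>C - v + a\<close>, since without cycle-piercing edges \<open>a\<close> and \<open>v\<close> are parallel; and two distinct cycles
  cannot have the same arc into each head they share, since going backwards from a common arc would
  identify them. Circuit elimination passes to all minors, which gives W-chordality. The faces of the
  directed tree complex are the sets containing no hyperedge, that is, the independent sets of a
  matroid, and the lexicographic order of the bases is a shelling.\<close>

section \<open>Circuit elimination\<close>

text \<open>This is the weak elimination axiom alone, without the antichain condition on circuits:
  hyperedges may be nested when \<open>D\<close> has parallel loops.\<close>

definition circuit_elimination :: "'v set set \<Rightarrow> bool" where
  "circuit_elimination F \<longleftrightarrow>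
     (\<forall>e1\<in>F. \<forall>e2\<in>F. \<forall>v\<in>e1 \<inter> e2. e1 \<noteq> e2 \<longrightarrow> (\<exists>e3\<in>F. e3 \<subseteq> (e1 \<union> e2) - {v}))"

lemma circuit_eliminationE:
  assumes "circuit_elimination F" "e1 \<in> F" "e2 \<in> F" "v \<in> e1" "v \<in> e2" "e1 \<noteq> e2"
  obtains e3 where "e3 \<in> F" "e3 \<subseteq> (e1 \<union> e2) - {v}"
  using assms unfolding circuit_elimination_def by blast

text \<open>Contraction keeps only inclusion-minimal sets, so a set produced by elimination has to
  be shrunk to one of them.\<close>

lemma ex_minimal_subset:
  assumes "finite e" "e \<in> F"
  shows "\<exists>f\<in>minimal_sets F. f \<subseteq> e"
  using assms
proof (induction rule: finite_psubset_induct)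
  case (psubset e)
  show ?case
  proof (cases "e \<in> minimal_sets F")
    case False
    then obtain f where "f \<in> F" "f \<subset> e"
      using psubset.prems by (auto simp: minimal_sets_def)
    then show ?thesis
      using psubset.IH[of f] by blast
  qed blast
qed

section \<open>Passage to minors\<close>

lemma circuit_elimination_deletion:
  assumes "circuit_elimination (hedges H)"
  shows "circuit_elimination (hedges (deletion H x))"
  unfolding circuit_elimination_def
proof (intro ballI impI)
  fix e1 e2 v
  assume e: "e1 \<in> hedges (deletion H x)" "e2 \<in> hedges (deletion H x)"
    and v: "v \<in> e1 \<inter> e2" and "e1 \<noteq> e2"
  then obtain e3 where e3: "e3 \<in> hedges H" "e3 \<subseteq> (e1 \<union> e2) - {v}"
    using circuit_eliminationE[OF assms, of e1 e2 v] by (auto simp: deletion_def)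
  then have "e3 \<in> hedges (deletion H x)"
    using e by (auto simp: deletion_def)
  then show "\<exists>e3\<in>hedges (deletion H x). e3 \<subseteq> (e1 \<union> e2) - {v}"
    using e3 by blast
qed

text \<open>Both edges lift to hyperedges of \<open>H\<close>, which differ because their traces do.
  Eliminating there, removing \<open>x\<close> and shrinking to a minimal set stays inside the
  required union.\<close>

lemma circuit_elimination_contraction:
  assumes elim: "circuit_elimination (hedges H)" and fin: "\<forall>e\<in>hedges H. finite e"
  shows "circuit_elimination (hedges (contraction H x))"
  unfolding circuit_elimination_def
proof (intro ballI impI)
  fix e1 e2 v
  assume "e1 \<in> hedges (contraction H x)" "e2 \<in> hedges (contraction H x)"
    and v: "v \<in> e1 \<inter> e2" and "e1 \<noteq> e2"
  then obtain f1 f2 where f: "f1 \<in> hedges H" "f2 \<in> hedges H" "e1 = f1 - {x}" "e2 = f2 - {x}"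
    by (auto simp: contraction_def minimal_sets_def)
  then obtain f3 where f3: "f3 \<in> hedges H" "f3 \<subseteq> (f1 \<union> f2) - {v}"
    using circuit_eliminationE[OF elim, of f1 f2 v] v \<open>e1 \<noteq> e2\<close> by blast
  obtain e3 where "e3 \<in> hedges (contraction H x)" "e3 \<subseteq> f3 - {x}"
    using ex_minimal_subset[of "f3 - {x}" "(\<lambda>e. e - {x}) ` hedges H"] f3(1) fin
    by (auto simp: contraction_def)
  then show "\<exists>e3\<in>hedges (contraction H x). e3 \<subseteq> (e1 \<union> e2) - {v}"
    using f f3 by blast
qed

text \<open>Finiteness is carried through the induction since the contraction step needs minimal
  subsets to exist.\<close>

lemma circuit_elimination_minor:
  assumes "minor H K" "circuit_elimination (hedges H)" "\<forall>e\<in>hedges H. finite e"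
  shows "circuit_elimination (hedges K) \<and> (\<forall>e\<in>hedges K. finite e)"
  using assms
proof (induction rule: minor.induct)
  case (minor_del K v)
  then show ?case
    using circuit_elimination_deletion[of K v] by (auto simp: deletion_def)
next
  case (minor_contr K v)
  then show ?case
    using circuit_elimination_contraction[of K v]
    by (auto simp: contraction_def minimal_sets_def)
qed blast

lemma W_chordal_if_circuit_elimination:
  assumes "circuit_elimination (hedges H)" "\<forall>e\<in>hedges H. finite e"
  shows "W_chordal H"
  unfolding W_chordal_def
proof (intro allI impI, elim conjE)
  fix K
  assume "minor H K" "hverts K \<noteq> {}"
  then obtain v where "v \<in> hverts K"
    by blast
  moreover have "circuit_elimination (hedges K)"
    using circuit_elimination_minor[OF \<open>minor H K\<close>] assms by blast
  ultimately show "\<exists>v. simplicial_vertex K v"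
    unfolding simplicial_vertex_def circuit_elimination_def by blast
qed

section \<open>Shellability of matroid complexes\<close>

definition independence_complex :: "'v set \<Rightarrow> 'v set set \<Rightarrow> 'v set set" where
  "independence_complex V F = {\<sigma>. \<sigma> \<subseteq> V \<and> (\<forall>e\<in>F. \<not> e \<subseteq> \<sigma>)}"

text \<open>Maximality can be tested on single additional vertices, because a set containing a
  dependent set is dependent.\<close>

lemma facet_independence_complex_iff:
  "B \<in> facets (independence_complex V F) \<longleftrightarrow>
     B \<in> independence_complex V F \<and> (\<forall>z\<in>V - B. \<exists>e\<in>F. e \<subseteq> insert z B)"
proof (intro iffI conjI ballI)
  fix z
  assume B: "B \<in> facets (independence_complex V F)" and z: "z \<in> V - B"
  then have "insert z B \<notin> independence_complex V F"
    by (auto simp: facets_def)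
  then show "\<exists>e\<in>F. e \<subseteq> insert z B"
    using B z by (auto simp: facets_def independence_complex_def)
next
  assume B: "B \<in> independence_complex V F \<and> (\<forall>z\<in>V - B. \<exists>e\<in>F. e \<subseteq> insert z B)"
  have "B = \<tau>" if \<tau>: "\<tau> \<in> independence_complex V F" "B \<subseteq> \<tau>" for \<tau>
  proof (rule ccontr)
    assume "B \<noteq> \<tau>"
    then obtain z where z: "z \<in> \<tau>" "z \<notin> B"
      using \<tau>(2) by blast
    then obtain e where "e \<in> F" "e \<subseteq> insert z B"
      using B \<tau>(1) unfolding independence_complex_def by blast
    then show False
      using z \<tau> unfolding independence_complex_def by blast
  qed
  with B show "B \<in> facets (independence_complex V F)"
    by (simp add: facets_def)
qed (simp add: facets_def)

text \<open>The inserted \<open>y\<close> is prescribed and the removed \<open>x\<close> is found,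
  as the shelling needs. Adding \<open>y\<close> to \<open>B\<close> creates a circuit
  \<open>C\<close>, and any element of \<open>C\<close> outside \<open>A\<close> can serve as
  \<open>x\<close>.\<close>

lemma basis_exchange:
  assumes elim: "circuit_elimination F"
    and A: "A \<in> facets (independence_complex V F)"
    and B: "B \<in> facets (independence_complex V F)"
    and y: "y \<in> A - B"
  obtains x where "x \<in> B - A" "insert y (B - {x}) \<in> facets (independence_complex V F)"
proof -
  have indep: "\<not> e \<subseteq> A" "\<not> e \<subseteq> B" if "e \<in> F" for e
    using A B that by (auto simp: facets_def independence_complex_def)
  have V: "A \<subseteq> V" "B \<subseteq> V"
    using A B by (auto simp: facets_def independence_complex_def)
  obtain C where C: "C \<in> F" "C \<subseteq> insert y B"
    using B y V unfolding facet_independence_complex_iff by blast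
  then have yC: "y \<in> C"
    using indep by blast
  obtain x where x: "x \<in> C" "x \<notin> A"
    using indep(1) C(1) by blast
  then have xB: "x \<in> B" "x \<noteq> y"
    using C(2) y by auto
  let ?B = "insert y (B - {x})"
  have "\<not> e \<subseteq> ?B" if e: "e \<in> F" for e
  proof
    assume sub: "e \<subseteq> ?B"
    moreover from this have "y \<in> e" "x \<notin> e"
      using indep(2)[OF e] xB by blast+
    \<comment> \<open>\<open>C\<close> contains \<open>x\<close> and \<open>e\<close> does not, so
      they differ. Eliminating \<open>y\<close> leaves a member of \<open>F\<close> inside
      \<open>B\<close>.\<close>
    ultimately obtain e3 where "e3 \<in> F" "e3 \<subseteq> (C \<union> e) - {y}"
      using circuit_eliminationE[OF elim C(1) e yC] x(1) by metis
    then show False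
      using indep(2) sub C(2) by blast
  qed
  moreover have "\<exists>e\<in>F. e \<subseteq> insert z ?B" if z: "z \<in> V - ?B" for z
  proof (cases "z = x")
    case True
    then show ?thesis
      using C by blast
  next
    case False
    then obtain e where e: "e \<in> F" "e \<subseteq> insert z B"
      using B z unfolding facet_independence_complex_iff by blast
    show ?thesis
    proof (cases "x \<in> e")
      case True
      \<comment> \<open>A dependent set through \<open>x\<close> is traded, via \<open>C\<close>,
        for one avoiding \<open>x\<close>; the element \<open>z\<close> tells \<open>e\<close> and
        \<open>C\<close> apart.\<close>
      have "z \<in> e"
        using indep(2) e by blast
      moreover have "z \<notin> C"
        using C(2) z False by blast
      ultimately obtain e3 where "e3 \<in> F" "e3 \<subseteq> (C \<union> e) - {x}"
        using circuit_eliminationE[OF elim C(1) e(1) x(1) True] by metis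
      then show ?thesis
        using C(2) e(2) by (intro bexI[of _ e3]) auto
    qed (use e in blast)
  qed
  moreover have "?B \<subseteq> V"
    using V y by blast
  ultimately have "?B \<in> facets (independence_complex V F)"
    unfolding facet_independence_complex_iff by (simp add: independence_complex_def)
  then show thesis
    using that[of x] x xB by blast
qed

section \<open>Comparing sets as binary numbers\<close>

text \<open>Binary numbers are compared at the highest digit in which they differ, here the maximum
  \<open>m\<close> of the symmetric difference.\<close>

lemma set_encode_less_imp_greatest:
  assumes fin: "finite A" "finite B" and less: "set_encode B < set_encode A"
  obtains y where "y \<in> A - B" "\<forall>x\<in>B - A. x < y"
proof -
  let ?S = "(A - B) \<union> (B - A)"
  have S: "finite ?S" "?S \<noteq> {}"
    using assms by auto
  define m where "m = Max ?S"
  have m: "m \<in> ?S" and le: "\<forall>x\<in>?S. x \<le> m"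
    using Max_in[OF S] Max_ge[OF S(1)] by (auto simp: m_def)
  have "m \<notin> B - A"
  proof
    assume mB: "m \<in> B - A"
    have "A - B \<subseteq> {..<m}"
      using le mB by (force simp: le_less)
    then have "(\<Sum>a\<in>A - B. 2 ^ a) \<le> (\<Sum>a<m. 2 ^ a :: nat)"
      by (intro sum_mono2) auto
    \<comment> \<open>All digits below place \<open>m\<close> together are worth
      \<open>2 ^ m - 1\<close>, less than the digit at \<open>m\<close>.\<close>
    also have "\<dots> < 2 ^ m"
      by (simp add: lessThan_atLeast0 sum_power2)
    also have "\<dots> \<le> (\<Sum>a\<in>B - A. 2 ^ a :: nat)"
      using mB fin by (intro member_le_sum) auto
    finally have "(\<Sum>a\<in>A - B. 2 ^ a) < (\<Sum>a\<in>B - A. 2 ^ a :: nat)" .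
    moreover have "set_encode A = (\<Sum>a\<in>A \<inter> B. 2 ^ a) + (\<Sum>a\<in>A - B. 2 ^ a)"
      using sum.Int_Diff[OF fin(1), of _ B] by (simp add: set_encode_def)
    moreover have "set_encode B = (\<Sum>a\<in>A \<inter> B. 2 ^ a) + (\<Sum>a\<in>B - A. 2 ^ a)"
      using sum.Int_Diff[OF fin(2), of _ A] by (simp add: set_encode_def Int_commute)
    ultimately show False
      using less by simp
  qed
  with m have "m \<in> A - B"
    by blast
  moreover from this have "\<forall>x\<in>B - A. x < m"
    using le by (auto simp: le_less)
  ultimately show thesis
    by (rule that)
qed

lemma set_encode_exchange_less:
  assumes "finite B" "x \<in> B" "y \<notin> B" "x < y"
  shows "set_encode B < set_encode (insert y (B - {x}))"
proof -
  have "set_encode B = 2 ^ x + set_encode (B - {x})"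
    using assms by (metis set_encode_insert finite_Diff insert_Diff insert_Diff_single Diff_iff singletonI)
  moreover have "set_encode (insert y (B - {x})) = 2 ^ y + set_encode (B - {x})"
    using assms by (intro set_encode_insert) auto
  ultimately show ?thesis
    using assms(4) by simp
qed

section \<open>Shellings from weights\<close>

text \<open>Listing facets by decreasing weight gives a shelling: the exchange places the
  intersection of \<open>B\<close> with any earlier \<open>A\<close> inside a face
  \<open>B - {x}\<close> that also lies in an earlier facet.\<close>

lemma shellable_if_weighted_exchange:
  fixes w :: "'v set \<Rightarrow> nat"
  assumes fin: "finite (facets K)" "\<forall>B\<in>facets K. finite B"
    and inj: "inj_on w (facets K)"
    and exchange: "\<And>A B. \<lbrakk>A \<in> facets K; B \<in> facets K; w B < w A\<rbrakk> \<Longrightarrow>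
      \<exists>x y. x \<in> B - A \<and> insert y (B - {x}) \<in> facets K \<and> w B < w (insert y (B - {x}))"
  shows "shellable K"
proof -
  obtain Bs where Bs: "set Bs = facets K" "distinct Bs"
    using finite_distinct_list[OF fin(1)] by blast
  \<comment> \<open>\<open>sort_key\<close> sorts upwards, so the negated weight puts the heaviest
    facet first.\<close>
  define \<sigma>s where "\<sigma>s = sort_key (\<lambda>B. - int (w B)) Bs"
  have \<sigma>s: "set \<sigma>s = facets K" "distinct \<sigma>s"
    using Bs by (simp_all add: \<sigma>s_def)
  have le: "w (\<sigma>s ! j) \<le> w (\<sigma>s ! i)" if "i \<le> j" "j < length \<sigma>s" for i j
    using sorted_nth_mono[of "map (\<lambda>B. - int (w B)) \<sigma>s" i j] that by (simp add: \<sigma>s_def)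
  \<comment> \<open>Since weights are injective on facets, the earlier facets are exactly the
    strictly heavier ones.\<close>
  have before: "A \<in> set (take j \<sigma>s) \<longleftrightarrow> A \<in> facets K \<and> w (\<sigma>s ! j) < w A"
    if j: "j < length \<sigma>s" for A j
  proof
    assume "A \<in> set (take j \<sigma>s)"
    then obtain i where i: "i < j" "A = \<sigma>s ! i"
      using j by (auto simp: in_set_conv_nth)
    then have "A \<noteq> \<sigma>s ! j" "A \<in> facets K" "\<sigma>s ! j \<in> facets K"
      using \<sigma>s j by (auto simp: nth_eq_iff_index_eq simp flip: \<sigma>s(1))
    then have "w A \<noteq> w (\<sigma>s ! j)"
      using inj by (auto dest: inj_onD)
    then show "A \<in> facets K \<and> w (\<sigma>s ! j) < w A"
      using le[of i j] i j \<open>A \<in> facets K\<close> by simp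
  next
    assume A: "A \<in> facets K \<and> w (\<sigma>s ! j) < w A"
    then obtain i where i: "i < length \<sigma>s" "A = \<sigma>s ! i"
      using \<sigma>s(1) by (metis in_set_conv_nth)
    have "i < j"
      using le[of j i] i A by (meson leD not_less)
    then show "A \<in> set (take j \<sigma>s)"
      using i j by (auto simp: in_set_conv_nth)
  qed
  have "face_dim \<tau> = face_dim (\<sigma>s ! j) - 1"
    if j: "j < length \<sigma>s"
      and \<tau>: "\<tau> \<in> facets (generated_complex {\<sigma>s ! j} \<inter> generated_complex (set (take j \<sigma>s)))"
    for j \<tau>
  proof -
    let ?L = "generated_complex {\<sigma>s ! j} \<inter> generated_complex (set (take j \<sigma>s))"
    let ?B = "\<sigma>s ! j"
    have B: "?B \<in> facets K"
      using \<sigma>s(1) j nth_mem by blast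
    obtain A where A: "A \<in> facets K" "w ?B < w A" "\<tau> \<subseteq> A" "\<tau> \<subseteq> ?B"
      using \<tau> before[OF j] by (auto simp: facets_def generated_complex_def)
    obtain x y where xy: "x \<in> ?B - A" "insert y (?B - {x}) \<in> facets K"
      "w ?B < w (insert y (?B - {x}))"
      using exchange[OF A(1) B A(2)] by blast
    have "insert y (?B - {x}) \<in> set (take j \<sigma>s)"
      using before[OF j] xy by blast
    then have "?B - {x} \<in> ?L"
      by (auto simp: generated_complex_def)
    moreover have "\<tau> \<subseteq> ?B - {x}"
      using A xy by blast
    \<comment> \<open>Maximality of \<open>\<tau>\<close> in the intersection turns the inclusion
      into equality.\<close>
    ultimately have "\<tau> = ?B - {x}"
      using \<tau> by (simp add: facets_def)
    moreover have "card ?B = Suc (card (?B - {x}))"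
      using xy(1) fin(2) B by (intro card.remove) auto
    ultimately show ?thesis
      by (simp add: face_dim_def)
  qed
  then show ?thesis
    unfolding shellable_def pure_of_dim_def using \<sigma>s by blast
qed

text \<open>The weight is the binary encoding of a facet under a numbering \<open>g\<close> of the
  vertices, which orders facets lexicographically from the largest number down.\<close>

lemma shellable_independence_complex:
  assumes elim: "circuit_elimination F" and V: "finite V"
  shows "shellable (independence_complex V F)"
proof -
  let ?K = "independence_complex V F"
  obtain g :: "'a \<Rightarrow> nat" where g: "inj_on g V"
    using finite_imp_inj_to_nat_seg[OF V] by blast
  have sub: "facets ?K \<subseteq> Pow V"
    by (auto simp: facets_def independence_complex_def)
  then have finB: "finite B" if "B \<in> facets ?K" for B
    using that V finite_subset by blast
  show ?thesis
  proof (rule shellable_if_weighted_exchange[where w = "\<lambda>B. set_encode (g ` B)"])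
    show "finite (facets ?K)"
      using sub V by (meson finite_Pow_iff finite_subset)
    show "inj_on (\<lambda>B. set_encode (g ` B)) (facets ?K)"
    proof (rule inj_onI)
      fix A B
      assume AB: "A \<in> facets ?K" "B \<in> facets ?K" "set_encode (g ` A) = set_encode (g ` B)"
      then have "g ` A = g ` B"
        using finB by (simp add: set_encode_eq)
      then show "A = B"
        using inj_on_image_eq_iff[OF g, of A B] AB(1,2) sub by auto
    qed
    fix A B
    assume A: "A \<in> facets ?K" and B: "B \<in> facets ?K"
      and less: "set_encode (g ` B) < set_encode (g ` A)"
    have AB: "A \<subseteq> V" "B \<subseteq> V" "finite A" "finite B"
      using A B sub finB by auto
    \<comment> \<open>As \<open>n\<close> exceeds every number in \<open>B\<close> but not in
      \<open>A\<close>, inserting its vertex raises the weight whichever \<open>x\<close> the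
      exchange removes.\<close>
    obtain n where n: "n \<in> g ` A - g ` B" "\<forall>x\<in>g ` B - g ` A. x < n"
      using set_encode_less_imp_greatest[OF _ _ less] AB by blast
    then obtain y where y: "y \<in> A - B" "n = g y"
      by blast
    obtain x where x: "x \<in> B - A" "insert y (B - {x}) \<in> facets ?K"
      using basis_exchange[OF elim A B y(1)] .
    have "g x \<in> g ` B - g ` A"
      using x(1) AB inj_on_image_mem_iff[OF g, of x A] by blast
    then have "set_encode (g ` B) < set_encode (insert (g y) (g ` B - {g x}))"
      using n y(2) AB by (intro set_encode_exchange_less) auto
    also have "insert (g y) (g ` B - {g x}) = g ` insert y (B - {x})"
      using inj_on_image_set_diff[OF g, of B "{x}"] x(1) AB by auto
    finally show "\<exists>x y. x \<in> B - A \<and> insert y (B - {x}) \<in> facets ?K \<and>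
        set_encode (g ` B) < set_encode (g ` insert y (B - {x}))"
      using x by blast
  qed (use finB in blast)
qed

section \<open>The tree conflict hypergraph\<close>

text \<open>Being a directed cycle depends only on the endpoints of the arcs and their
  multiplicities. This serves to replace one arc of a cycle by a parallel one.\<close>

lemma directed_cycle_image:
  assumes cyc: "directed_cycle (edge_subgraph D \<sigma>)"
    and inj: "inj_on \<phi> \<sigma>"
    and pres: "\<And>e. e \<in> \<sigma> \<Longrightarrow> tail D (\<phi> e) = tail D e \<and> head D (\<phi> e) = head D e"
  shows "directed_cycle (edge_subgraph D (\<phi> ` \<sigma>))"
proof -
  have img: "tail D ` \<phi> ` \<sigma> = tail D ` \<sigma>" "head D ` \<phi> ` \<sigma> = head D ` \<sigma>"
    using pres by (auto simp: image_image)
  have "mk_symmetric (edge_subgraph D (\<phi> ` \<sigma>)) = mk_symmetric (edge_subgraph D \<sigma>)"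
    using pres by (simp add: mk_symmetric_def img)
  then have "connected (edge_subgraph D (\<phi> ` \<sigma>))"
    using cyc by (simp add: directed_cycle_def connected_def)
  moreover have "\<not> parallel D e f" if "e \<in> \<phi> ` \<sigma>" "f \<in> \<phi> ` \<sigma>" for e f
    using that directed_cycle_unique(1)[OF cyc] pres unfolding parallel_def by (metis imageE)
  moreover have "card {g \<in> \<phi> ` \<sigma>. head D g = v} = 1" "card {g \<in> \<phi> ` \<sigma>. tail D g = v} = 1"
    if v: "v \<in> tail D ` \<sigma> \<union> head D ` \<sigma>" for v
  proof -
    have "{g \<in> \<phi> ` \<sigma>. head D g = v} = \<phi> ` {g \<in> \<sigma>. head D g = v}"
      "{g \<in> \<phi> ` \<sigma>. tail D g = v} = \<phi> ` {g \<in> \<sigma>. tail D g = v}"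
      using pres by auto
    moreover have "card (\<phi> ` {g \<in> \<sigma>. P g}) = card {g \<in> \<sigma>. P g}" for P
      using inj by (intro card_image) (auto intro: inj_on_subset)
    ultimately show "card {g \<in> \<phi> ` \<sigma>. head D g = v} = 1" "card {g \<in> \<phi> ` \<sigma>. tail D g = v} = 1"
      using directed_cycle_degree[OF cyc v] by simp_all
  qed
  ultimately show ?thesis
    unfolding directed_cycle_def in_degree_def out_degree_def in_arcs_def out_arcs_def
      edge_subgraph_simps img by blast
qed

text \<open>Walking backwards round a cycle visits every arc. Formally, the tails of
  \<open>S\<close> are among its heads, counting makes the two sets equal, and connectedness then
  forces \<open>S\<close> to be everything.\<close>

lemma directed_cycle_predecessor_closed:
  assumes cyc: "directed_cycle (edge_subgraph D \<sigma>)" and fin: "finite \<sigma>"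
    and S: "S \<subseteq> \<sigma>" "S \<noteq> {}"
    and pred: "\<And>e f. \<lbrakk>f \<in> S; e \<in> \<sigma>; head D e = tail D f\<rbrakk> \<Longrightarrow> e \<in> S"
  shows "S = \<sigma>"
proof -
  let ?V = "tail D ` S \<union> head D ` S"
  have "head D ` S \<supseteq> tail D ` S"
  proof
    fix v
    assume "v \<in> tail D ` S"
    then obtain f where f: "f \<in> S" "v = tail D f"
      by blast
    then obtain e where "e \<in> \<sigma>" "head D e = v"
      using directed_cycle_edges(1)[OF cyc, of v] S(1) by blast
    then show "v \<in> head D ` S"
      using pred f by blast
  qed
  \<comment> \<open>Both maps are injective on a cycle, so both images have as many elements as
    \<open>S\<close>.\<close>
  moreover have "card (tail D ` S) = card (head D ` S)"
    using directed_cycle_unique[OF cyc] S(1)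
    by (subst (1 2) card_image) (blast intro: inj_onI)+
  ultimately have ends: "tail D ` S = head D ` S"
    using fin S(1) by (metis card_subset_eq finite_imageI finite_subset)
  \<comment> \<open>An arc touching \<open>S\<close> shares its tail or its head with an arc of
    \<open>S\<close>, and either determines an arc of the cycle.\<close>
  have closed: "e \<in> S" if e: "e \<in> \<sigma>" "tail D e \<in> ?V \<or> head D e \<in> ?V" for e
  proof -
    have "tail D e \<in> tail D ` S \<or> head D e \<in> head D ` S"
      using e(2) ends by blast
    then obtain g where "g \<in> S" "tail D e = tail D g \<or> head D e = head D g"
      by blast
    then show ?thesis
      using directed_cycle_unique[OF cyc e(1), of g] S(1) by blast
  qed
  obtain u where u: "u \<in> ?V"
    using S(2) by blast
  have r: "v \<in> ?V" if "u \<rightarrow>\<^sup>*\<^bsub>mk_symmetric (edge_subgraph D \<sigma>)\<^esub> v" for v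
    using that unfolding reachable_def
  proof (induction rule: rtrancl_on_induct)
    case base
    show ?case by (rule u)
  next
    case (step a b)
    have "(a, b) \<in> parcs (mk_symmetric (edge_subgraph D \<sigma>))"
      using step(2) by simp
    then obtain e where "e \<in> \<sigma>" "a = tail D e \<and> b = head D e \<or> a = head D e \<and> b = tail D e"
      unfolding parcs_mk_symmetric by auto
    moreover from this have "e \<in> S"
      using closed[of e] step.IH by metis
    ultimately show ?case
      by auto
  qed
  have "e \<in> S" if e: "e \<in> \<sigma>" for e
  proof -
    have "u \<in> tail D ` \<sigma> \<union> head D ` \<sigma>" "tail D e \<in> tail D ` \<sigma> \<union> head D ` \<sigma>"
      using u S(1) e by auto
    then have "u \<rightarrow>\<^sup>*\<^bsub>mk_symmetric (edge_subgraph D \<sigma>)\<^esub> tail D e"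
      using cyc by (simp add: directed_cycle_def connected_def strongly_connected_def)
    then show ?thesis
      using r closed[OF e] by blast
  qed
  then show ?thesis
    using S(1) by blast
qed

text \<open>If the cycles agreed at every common head, their intersection, nonempty by
  \<open>v\<close>, would be closed under predecessors. Then \<open>\<sigma>\<close> would lie in
  \<open>\<tau>\<close> and equal it.\<close>

lemma distinct_directed_cycles_conflict:
  assumes \<sigma>: "directed_cycle (edge_subgraph D \<sigma>)" "finite \<sigma>"
    and \<tau>: "directed_cycle (edge_subgraph D \<tau>)"
    and v: "v \<in> \<sigma>" "v \<in> \<tau>" and ne: "\<sigma> \<noteq> \<tau>"
  obtains e f where "e \<in> \<sigma> - {v}" "f \<in> \<tau> - {v}" "e \<noteq> f" "head D e = head D f"
proof -
  have "\<exists>e f. e \<in> \<sigma> \<and> f \<in> \<tau> \<and> e \<noteq> f \<and> head D e = head D f"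
  proof (rule ccontr)
    assume "\<not> ?thesis"
    then have same: "e = f" if "e \<in> \<sigma>" "f \<in> \<tau>" "head D e = head D f" for e f
      using that by blast
    have "\<sigma> \<inter> \<tau> = \<sigma>"
    proof (rule directed_cycle_predecessor_closed[OF \<sigma>])
      fix e f
      assume e: "f \<in> \<sigma> \<inter> \<tau>" "e \<in> \<sigma>" "head D e = tail D f"
      then obtain g where "g \<in> \<tau>" "head D g = tail D f"
        using directed_cycle_edges(1)[OF \<tau>, of "tail D f"] by blast
      then show "e \<in> \<sigma> \<inter> \<tau>"
        using same e by (metis IntI)
    qed (use v in auto)
    then show False
      using directed_cycle_minimal[OF \<sigma>(1) \<tau>] ne by blast
  qed
  then obtain e f where ef: "e \<in> \<sigma>" "f \<in> \<tau>" "e \<noteq> f" "head D e = head D f"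
    by blast
  \<comment> \<open>If one of the arcs were \<open>v\<close>, the other would be the arc into the
    same head in a cycle through \<open>v\<close>, hence \<open>v\<close> as well.\<close>
  then have "e \<noteq> v" "f \<noteq> v"
    using directed_cycle_unique(1)[OF \<tau>, of f v] directed_cycle_unique(1)[OF \<sigma>(1), of e v] v
    by metis+
  then show thesis
    using that ef by blast
qed

section \<open>Conflicts and forests\<close>

text \<open>Two distinct arcs with a common head are parallel or have different tails, so the two
  families of pairs merge.\<close>

lemma hedges_tree_conflict:
  "hedges (tree_conflict_hypergraph D) =
     {\<sigma>. \<sigma> \<subseteq> arcs D \<and> directed_cycle (edge_subgraph D \<sigma>)} \<union>
     {{e, f} | e f. e \<in> arcs D \<and> f \<in> arcs D \<and> e \<noteq> f \<and> head D e = head D f}"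
  by (auto simp: tree_conflict_hypergraph_def parallel_def)

text \<open>Two cycles through \<open>v\<close> yield a pair, a cycle and a pair yield another
  cycle, and two pairs yield the pair of their other arcs.\<close>

lemma circuit_elimination_tree_conflict:
  assumes fin: "fin_digraph D" and pierce: "\<not> (\<exists>e. cycle_piercing D e)"
  shows "circuit_elimination (hedges (tree_conflict_hypergraph D))"
proof -
  let ?H = "hedges (tree_conflict_hypergraph D)"
  let ?C = "\<lambda>\<sigma>. \<sigma> \<subseteq> arcs D \<and> directed_cycle (edge_subgraph D \<sigma>)"
  have finC: "finite \<sigma>" if "?C \<sigma>" for \<sigma>
    using that fin_digraph.finite_arcs[OF fin] finite_subset by blast
  have pairI: "{e, f} \<in> ?H" if "e \<in> arcs D" "f \<in> arcs D" "e \<noteq> f" "head D e = head D f" for e f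
    using that unfolding hedges_tree_conflict by blast
  have star: "?C \<sigma> \<or> (\<exists>a. \<sigma> = {v, a} \<and> v \<in> arcs D \<and> a \<in> arcs D \<and> a \<noteq> v \<and> head D a = head D v)"
    if "\<sigma> \<in> ?H" "v \<in> \<sigma>" for \<sigma> v
    using that unfolding hedges_tree_conflict by auto
  have mixed: "\<exists>\<rho>\<in>?H. \<rho> \<subseteq> (\<sigma> \<union> {v, a}) - {v}"
    if \<sigma>: "?C \<sigma>" "v \<in> \<sigma>" and a: "a \<in> arcs D" "a \<noteq> v" "head D a = head D v" for \<sigma> v a
  proof -
    let ?\<phi> = "id(v := a)"
    have "tail D a = tail D v"
    proof (rule ccontr)
      assume "tail D a \<noteq> tail D v"
      then have "cycle_piercing D a"
        unfolding cycle_piercing_def using \<sigma> a by blast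
      with pierce show False
        by blast
    qed
    \<comment> \<open>The cycle already has \<open>v\<close> as its only arc into this head; hence
      \<open>?\<phi>\<close> is injective on it.\<close>
    moreover have "a \<notin> \<sigma>"
      using directed_cycle_unique(1)[of D \<sigma> a v] \<sigma> a by blast
    ultimately have "directed_cycle (edge_subgraph D (?\<phi> ` \<sigma>))"
      using \<sigma> a by (intro directed_cycle_image) (auto simp: inj_on_def)
    moreover have "?\<phi> ` \<sigma> = insert a (\<sigma> - {v})"
      using \<sigma>(2) by auto
    ultimately have "insert a (\<sigma> - {v}) \<in> ?H"
      using \<sigma>(1) a(1) unfolding hedges_tree_conflict by auto
    then show ?thesis
      by (rule bexI[rotated]) (use a(2) in auto)
  qed
  show ?thesis
    unfolding circuit_elimination_def
  proof (intro ballI impI)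
    fix \<sigma> \<tau> v
    assume H: "\<sigma> \<in> ?H" "\<tau> \<in> ?H" and v: "v \<in> \<sigma> \<inter> \<tau>" and ne: "\<sigma> \<noteq> \<tau>"
    consider (cc) "?C \<sigma>" "?C \<tau>"
      | (cp) a where "?C \<sigma>" "\<tau> = {v, a}" "a \<in> arcs D" "a \<noteq> v" "head D a = head D v"
      | (pc) a where "?C \<tau>" "\<sigma> = {v, a}" "a \<in> arcs D" "a \<noteq> v" "head D a = head D v"
      | (pp) a b where "\<sigma> = {v, a}" "a \<in> arcs D" "a \<noteq> v" "head D a = head D v"
          "\<tau> = {v, b}" "b \<in> arcs D" "b \<noteq> v" "head D b = head D v"
      using star[OF H(1), of v] star[OF H(2), of v] v by blast
    then show "\<exists>\<rho>\<in>?H. \<rho> \<subseteq> (\<sigma> \<union> \<tau>) - {v}"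
    proof cases
      case cc
      then obtain e f where ef: "e \<in> \<sigma> - {v}" "f \<in> \<tau> - {v}" "e \<noteq> f" "head D e = head D f"
        using distinct_directed_cycles_conflict[of D \<sigma> \<tau> v] finC v ne by blast
      then have "{e, f} \<in> ?H"
        using pairI cc by blast
      then show ?thesis
        by (rule bexI[rotated]) (use ef in blast)
    next
      case cp
      then show ?thesis
        using mixed[of \<sigma> v a] v by simp
    next
      case pc
      then show ?thesis
        using mixed[of \<tau> v a] v by (simp add: Un_commute)
    next
      case pp
      then have "{a, b} \<in> ?H"
        using pairI ne by metis
      then show ?thesis
        by (rule bexI[rotated]) (use pp in auto)
    qed
  qed
qed

text \<open>This makes the directed tree complex a matroid complex once circuit elimination
  holds.\<close>

lemma directed_tree_complex_eq:
  "directed_tree_complex D =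
     independence_complex (arcs D) (hedges (tree_conflict_hypergraph D))"
proof -
  have "directed_forest (edge_subgraph D \<sigma>) \<longleftrightarrow>
      (\<forall>\<rho>\<in>hedges (tree_conflict_hypergraph D). \<not> \<rho> \<subseteq> \<sigma>)" if \<sigma>: "\<sigma> \<subseteq> arcs D" for \<sigma>
  proof
    assume "directed_forest (edge_subgraph D \<sigma>)"
    then show "\<forall>\<rho>\<in>hedges (tree_conflict_hypergraph D). \<not> \<rho> \<subseteq> \<sigma>"
      by (auto simp: directed_forest_def hedges_tree_conflict)
  next
    assume R: "\<forall>\<rho>\<in>hedges (tree_conflict_hypergraph D). \<not> \<rho> \<subseteq> \<sigma>"
    have heads: "head D e \<noteq> head D f" if "e \<in> \<sigma>" "f \<in> \<sigma>" "e \<noteq> f" for e f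
    proof
      assume "head D e = head D f"
      then have "{e, f} \<in> hedges (tree_conflict_hypergraph D)"
        using that \<sigma> unfolding hedges_tree_conflict by blast
      then show False
        using R[rule_format, of "{e, f}"] that by simp
    qed
    moreover have "\<not> directed_cycle (edge_subgraph D \<rho>)" if "\<rho> \<subseteq> \<sigma>" for \<rho>
    proof
      assume "directed_cycle (edge_subgraph D \<rho>)"
      then have "\<rho> \<in> hedges (tree_conflict_hypergraph D)"
        using that \<sigma> unfolding hedges_tree_conflict by blast
      then show False
        using R[rule_format, of \<rho>] that by simp
    qed
    \<comment> \<open>Parallel arcs share a head, so \<open>heads\<close> excludes them too.\<close>
    ultimately show "directed_forest (edge_subgraph D \<sigma>)"
      by (auto simp: directed_forest_def parallel_def)
  qed
  then show ?thesis
    by (auto simp: directed_tree_complex_def independence_complex_def)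
qed

theorem theorem5p11:
  fixes D :: "('a, 'b) pre_digraph"
  assumes "fin_digraph D"
    and "\<not> (\<exists>e. cycle_piercing D e)"
  shows "W_chordal (tree_conflict_hypergraph D) \<and> shellable (directed_tree_complex D)"
proof -
  have "finite (arcs D)"
    using fin_digraph.finite_arcs[OF assms(1)] .
  then have "\<forall>e\<in>hedges (tree_conflict_hypergraph D). finite e"
    unfolding hedges_tree_conflict by (auto intro: finite_subset)
  then show ?thesis
    unfolding directed_tree_complex_eq
    using circuit_elimination_tree_conflict[OF assms] \<open>finite (arcs D)\<close>
    by (intro conjI W_chordal_if_circuit_elimination shellable_independence_complex)
qed

end
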